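(* Let $\mathcal H$ be a real Hilbert space, $p\ge1$, and let $\mathcal J:\mathcal H\to\mathbb R\cup\{+\infty\}$ be absolutely $p$-homogeneous, convex, proper and lower semicontinuous. Assume that $\mathrm{dom}(\mathcal J)\cap\mathcal N_{\mathcal J}^\perp\setminus\{0\}\neq\emptyset$. If the sublevel sets of $u\mapsto\|u\|+\mathcal J(u)$ are precompact, then the optimisation problem $$\inf_{u\in\mathcal N_{\mathcal J}^\perp\setminus\{0\}}\frac{p\,\mathcal J(u)}{\|u\|^p}$$ admits a minimiser. Furthermore, if $u\in\mathcal H$ is a minimiser, so is $C\cdot u$ for any $C\ne0$.
   Context: $\mathcal J$ is absolutely $p$-homogeneous if $\mathcal J(0)=0$ and $\mathcal J(cu)=|c|^p\mathcal J(u)$ for $c\ne0$, $u\in\mathcal H$. $\mathrm{dom}(\mathcal J)=\{u:\mathcal J(u)<\infty\}$. The null space $\mathcal N_{\mathcal J}=\{u:\mathcal J(u)=0\}$ is a closed linear subspace of $\mathcal H$ and $\mathcal N_{\mathcal J}^\perp$ is its orthogonal complement. *)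

theory Defs
  imports "HOL-Analysis.Analysis"
begin

text \<open>
  Functionals with values in the reals extended by plus infinity are functions into \<^typ>\<open>ereal\<close>;
  the value minus infinity is excluded by \<open>proper_functional\<close> below.
\<close>

definition eff_dom :: "('a \<Rightarrow> ereal) \<Rightarrow> 'a set" where
  "eff_dom J = {u. J u < \<infinity>}"

definition null_space_of :: "('a \<Rightarrow> ereal) \<Rightarrow> 'a set" where
  "null_space_of J = {u. J u = 0}"

definition proper_functional :: "('a \<Rightarrow> ereal) \<Rightarrow> bool" where
  "proper_functional J \<longleftrightarrow> (\<forall>u. J u \<noteq> -\<infinity>) \<and> eff_dom J \<noteq> {}"

definition abs_homogeneous :: "real \<Rightarrow> ('a::real_vector \<Rightarrow> ereal) \<Rightarrow> bool" where
  "abs_homogeneous p J \<longleftrightarrow>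
     J 0 = 0 \<and> (\<forall>c u. c \<noteq> 0 \<longrightarrow> J (c *\<^sub>R u) = ereal (\<bar>c\<bar> powr p) * J u)"

text \<open>
  Since \<open>0 * \<infinity> = 0\<close> in \<^typ>\<open>ereal\<close>, the cases \<open>t = 0\<close> and \<open>t = 1\<close> hold trivially.
\<close>

definition convex_functional :: "('a::real_vector \<Rightarrow> ereal) \<Rightarrow> bool" where
  "convex_functional J \<longleftrightarrow>
     (\<forall>u v. \<forall>t\<in>{0..1::real}.
        J ((1 - t) *\<^sub>R u + t *\<^sub>R v) \<le> ereal (1 - t) * J u + ereal t * J v)"

definition lower_semicontinuous :: "('a::topological_space \<Rightarrow> ereal) \<Rightarrow> bool" where
  "lower_semicontinuous J \<longleftrightarrow> (\<forall>u. J u \<le> Liminf (at u) J)"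

definition precompact :: "'a::topological_space set \<Rightarrow> bool" where
  "precompact S \<longleftrightarrow> compact (closure S)"

definition rayleigh_quotient :: "real \<Rightarrow> ('a::real_normed_vector \<Rightarrow> ereal) \<Rightarrow> 'a \<Rightarrow> ereal" where
  "rayleigh_quotient p J u = ereal p * J u / ereal (norm u powr p)"

definition rayleigh_minimiser :: "real \<Rightarrow> ('a::real_inner \<Rightarrow> ereal) \<Rightarrow> 'a \<Rightarrow> bool" where
  "rayleigh_minimiser p J u \<longleftrightarrow>
     is_arg_min (rayleigh_quotient p J) (\<lambda>v. v \<in> (null_space_of J)\<^sup>\<bottom> - {0}) u"

end

theory Submission
  imports Defs
begin

text \<open>
  This is the direct method of the calculus of variations. The quotient is invariant under
  nonzero scalings (\<open>rayleigh_quotient_scaleR\<close>), because numerator and denominator are both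
  absolutely homogeneous of degree \<^term>\<open>p\<close>. This gives the second claim at once, since the
  orthogonal complement is a subspace, and it reduces the first claim to minimising \<^term>\<open>J\<close>
  over the unit vectors of the complement.

  The admissible direction \<^term>\<open>w\<close> of finite energy, normalised, cuts this set down to the unit
  vectors \<^term>\<open>v\<close> with \<open>J v \<le> J w\<close>. On them \<open>\<parallel>v\<parallel> + J v\<close> is bounded by the real number
  \<open>1 + J w\<close>, which is where nonnegativity of \<^term>\<open>J\<close> enters, so they lie in a precompact
  sublevel set; lower semicontinuity and the continuity of norm and inner product make the
  set of them closed, hence compact. A function with closed sublevel sets attains its minimum
  on a nonempty compact set. The constraint \<open>\<parallel>v\<parallel> = 1\<close> is kept in the limit because the
  compactness is in the norm topology, so the minimiser is not zero.
\<close>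

text \<open>
  A strict inequality \<open>a < J u\<close> persists on a punctured neighbourhood of \<^term>\<open>u\<close> by
  semicontinuity and holds at \<^term>\<open>u\<close> itself, hence on a full neighbourhood.
\<close>

lemma lower_semicontinuous_closed_sublevel:
  assumes "lower_semicontinuous J"
  shows "closed {u. J u \<le> a}"
proof -
  have "\<forall>\<^sub>F v in nhds u. a < J v" if "a < J u" for u
  proof -
    have "a < Liminf (at u) J"
      using that assms[unfolded lower_semicontinuous_def, rule_format, of u]
      by (rule less_le_trans)
    then have "\<forall>\<^sub>F v in at u. a < J v"
      by (rule less_LiminfD)
    then have "\<forall>\<^sub>F v in nhds u. v \<noteq> u \<longrightarrow> a < J v"
      by (simp add: eventually_at_filter)
    then show ?thesis
      by (rule eventually_mono) (use that in blast)
  qed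
  then have "\<exists>T. open T \<and> u \<in> T \<and> T \<subseteq> {u. a < J u}" if "u \<in> {u. a < J u}" for u
    using that unfolding eventually_nhds subset_eq by simp
  then have "open {u. a < J u}"
    by (rule topological_space_class.openI)
  moreover have "{u. J u \<le> a} = - {u. a < J u}"
    by auto
  ultimately show ?thesis
    by (simp add: closed_def)
qed

text \<open>
  The sets of points with value at most \<open>f x\<close>, for \<open>x \<in> K\<close>, are nested and nonempty, so by
  compactness they have a common point; any common point is a minimiser.
\<close>

lemma compact_attains_inf_of_closed_sublevels:
  fixes f :: "'a::topological_space \<Rightarrow> 'b::linorder"
  assumes "compact K" "K \<noteq> {}" and closed: "\<And>a. closed {u. f u \<le> a}"
  obtains x where "x \<in> K" "\<And>y. y \<in> K \<Longrightarrow> f x \<le> f y"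
proof -
  have "K \<inter> (\<Inter>x\<in>K. {u. f u \<le> f x}) \<noteq> {}"
  proof (rule compact_imp_fip_image[OF assms(1)])
    show "closed {u. f u \<le> f x}" if "x \<in> K" for x
      by (rule closed)
    fix I assume I: "finite I" "I \<subseteq> K"
    show "K \<inter> (\<Inter>x\<in>I. {u. f u \<le> f x}) \<noteq> {}"
    proof (cases "I = {}")
      case False
      define m where "m = arg_min_on f I"
      have "m \<in> I" "\<And>x. x \<in> I \<Longrightarrow> f m \<le> f x"
        using I False by (auto simp: m_def arg_min_if_finite arg_min_least)
      with I(2) show ?thesis
        by blast
    qed (use assms(2) in simp)
  qed
  then show ?thesis
    using that by auto
qed

text \<open>
  An absolutely homogeneous \<^term>\<open>J\<close> is even, so convexity at the midpoint \<^term>\<open>0\<close> of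
  \<^term>\<open>u\<close> and \<^term>\<open>-u\<close> bounds \<open>J 0 = 0\<close> by \<open>J u\<close>.
\<close>

lemma convex_abs_homogeneous_nonneg:
  assumes "abs_homogeneous p J" "convex_functional J"
  shows "0 \<le> J u"
proof -
  have "J (- u) = J ((-1) *\<^sub>R u)"
    by simp
  also have "\<dots> = ereal (\<bar>-1\<bar> powr p) * J u"
    using assms(1)[unfolded abs_homogeneous_def] by (metis neg_equal_0_iff_equal zero_neq_one)
  finally have even: "J (- u) = J u"
    by (simp flip: one_ereal_def)
  have "J ((1 - 1/2) *\<^sub>R u + (1/2) *\<^sub>R (- u)) \<le> ereal (1 - 1/2) * J u + ereal (1/2) * J (- u)"
    using assms(2)[unfolded convex_functional_def, rule_format, of "1/2" u "- u"] by simp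
  then have "0 \<le> ereal (1/2) * J u + ereal (1/2) * J u"
    using assms(1) by (simp add: abs_homogeneous_def even)
  then show ?thesis
    by (cases "J u") auto
qed

lemma rayleigh_quotient_scaleR:
  assumes "abs_homogeneous p J" "c \<noteq> 0"
  shows "rayleigh_quotient p J (c *\<^sub>R u) = rayleigh_quotient p J u"
proof (cases "u = 0")
  case False
  have "J (c *\<^sub>R u) = ereal (\<bar>c\<bar> powr p) * J u"
    using assms by (simp add: abs_homogeneous_def)
  moreover have "\<bar>c\<bar> powr p > 0" "norm u powr p > 0"
    using assms(2) False by auto
  ultimately show ?thesis
    by (cases "J u") (auto simp: rayleigh_quotient_def powr_mult divide_ereal_def)
qed simp

lemma closed_orthogonal_comp: "closed (W\<^sup>\<bottom>)"
proof -
  have "W\<^sup>\<bottom> = (\<Inter>y\<in>W. {x. y \<bullet> x = 0})"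
    by (auto simp: orthogonal_comp_def orthogonal_def)
  then show ?thesis
    by (auto intro!: closed_INT closed_Collect_eq continuous_intros)
qed

theorem theorem2p27:
  fixes J :: "'a::{real_inner, complete_space} \<Rightarrow> ereal" and p :: real
  assumes "p \<ge> 1"
    and "abs_homogeneous p J"
    and "convex_functional J"
    and "proper_functional J"
    and "lower_semicontinuous J"
    and "eff_dom J \<inter> (null_space_of J)\<^sup>\<bottom> - {0} \<noteq> {}"
    and "\<And>c::real. precompact {u. ereal (norm u) + J u \<le> ereal c}"
  shows "(\<exists>u. rayleigh_minimiser p J u) \<and>
         (\<forall>u C. rayleigh_minimiser p J u \<longrightarrow> C \<noteq> 0 \<longrightarrow> rayleigh_minimiser p J (C *\<^sub>R u))"
proof (intro conjI allI impI)
  define V where "V = (null_space_of J)\<^sup>\<bottom>"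
  have scale: "c *\<^sub>R v \<in> V" if "v \<in> V" for c v
    using that unfolding V_def by (intro subspace_scale subspace_orthogonal_comp)
  have minimiser_iff: "rayleigh_minimiser p J u \<longleftrightarrow>
      u \<in> V - {0} \<and> (\<forall>v\<in>V - {0}. rayleigh_quotient p J u \<le> rayleigh_quotient p J v)" for u
    by (auto simp: rayleigh_minimiser_def is_arg_min_linorder V_def)
  show "rayleigh_minimiser p J (C *\<^sub>R u)" if "rayleigh_minimiser p J u" "C \<noteq> 0" for u C
    using that by (auto simp: minimiser_iff scale rayleigh_quotient_scaleR[OF assms(2)])

  obtain w0 where w0: "w0 \<in> V" "w0 \<noteq> 0" "J w0 < \<infinity>"
    using assms(6) by (auto simp: eff_dom_def V_def)
  define w where "w = inverse (norm w0) *\<^sub>R w0"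
  have w: "w \<in> V" "norm w = 1"
    using w0 by (auto simp: w_def scale)
  have "J w = ereal (\<bar>inverse (norm w0)\<bar> powr p) * J w0"
    using assms(2) w0 by (simp add: abs_homogeneous_def w_def)
  then have "J w < \<infinity>"
    using w0(3) by (cases "J w0") auto
  then obtain M where M: "J w = ereal M"
    using convex_abs_homogeneous_nonneg[OF assms(2,3), of w] by (cases "J w") auto

  define K where "K = V \<inter> {v. norm v = 1} \<inter> {v. J v \<le> ereal M}"
  have "closed K"
    unfolding K_def V_def
    by (intro closed_Int closed_orthogonal_comp lower_semicontinuous_closed_sublevel assms
        closed_Collect_eq continuous_intros)
  moreover have "K \<subseteq> {u. ereal (norm u) + J u \<le> ereal (1 + M)}"
    by (auto simp: K_def simp flip: plus_ereal.simps(1) intro: add_left_mono)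
  then have "K \<subseteq> closure {u. ereal (norm u) + J u \<le> ereal (1 + M)}"
    using closure_subset by blast
  ultimately have "compact K"
    using assms(7)[of "1 + M"] unfolding precompact_def
    by (metis compact_Int_closed inf.absorb_iff2)
  moreover have "w \<in> K"
    using w M by (simp add: K_def)
  ultimately obtain u where u: "u \<in> K" "\<And>v. v \<in> K \<Longrightarrow> J u \<le> J v"
    using compact_attains_inf_of_closed_sublevels[of K J]
      lower_semicontinuous_closed_sublevel[OF assms(5)] by blast
  have min: "J u \<le> J v" if "v \<in> V" "norm v = 1" for v
  proof (cases "J v \<le> ereal M")
    case True
    then show ?thesis
      using that by (intro u(2)) (simp add: K_def)
  next
    case False
    then show ?thesis
      using u(1) by (auto simp: K_def)
  qed
  have "rayleigh_quotient p J u \<le> rayleigh_quotient p J v" if v: "v \<in> V" "v \<noteq> 0" for v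
  proof -
    define v' where "v' = inverse (norm v) *\<^sub>R v"
    have "norm u = 1"
      using u(1) by (simp add: K_def)
    moreover have "v' \<in> V" "norm v' = 1"
      using v by (auto simp: v'_def scale)
    ultimately have "rayleigh_quotient p J u \<le> rayleigh_quotient p J v'"
      using assms(1) min[of v']
      by (simp add: rayleigh_quotient_def ereal_mult_left_mono flip: one_ereal_def)
    also have "\<dots> = rayleigh_quotient p J v"
      using v(2) by (simp add: v'_def rayleigh_quotient_scaleR[OF assms(2)])
    finally show ?thesis .
  qed
  moreover have "u \<in> V - {0}"
    using u(1) by (auto simp: K_def)
  ultimately show "\<exists>u. rayleigh_minimiser p J u"
    by (auto simp: minimiser_iff)
qed

end
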